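(* Let $n=\prod_{i=1}^s p_i^{\alpha_i}$, where $s\ge 1$, $p_1,\dots,p_s$ are distinct primes and $\alpha_1,\dots,\alpha_s\ge 1$. Then $$\mathcal{Z}_{(\mathcal{U}_n,\mathbb{Z}_n)}=\mathcal{Z}_{(\mathcal{U}_{p_1^{\alpha_1}},\mathbb{Z}_{p_1^{\alpha_1}})}\circledast \mathcal{Z}_{(\mathcal{U}_{p_2^{\alpha_2}},\mathbb{Z}_{p_2^{\alpha_2}})}\circledast\cdots\circledast \mathcal{Z}_{(\mathcal{U}_{p_s^{\alpha_s}},\mathbb{Z}_{p_s^{\alpha_s}})}.$$
   Context: $\mathbb{Z}_n$ is the set of residues modulo $n$. $\mathcal{U}_n=\mathrm{Aut}(\mathbb{Z}_n)$ is identified with the set of residues $a$ modulo $n$ with $\gcd(a,n)=1$, where $a$ corresponds to the map $\pi_a(x)=ax \pmod n$; it acts on the $n$ points of $\mathbb{Z}_n$ by multiplication. For a permutation $\pi$ of a finite set with $N$ elements, $\mathrm{ctype}(\pi)=\prod_{i=1}^N x_i^{\lambda_i(\pi)}$, where $x_1,x_2,\dots$ are formal indeterminates and $\lambda_i(\pi)$ is the number of cycles of length $i$ (fixed points counted as cycles of length 1) in the disjoint cycle decomposition of $\pi$. The cycle index of a finite permutation group $G$ on a finite set $P$ is $\mathcal{Z}_{(G,P)}=\frac{1}{|G|}\sum_{\pi\in G}\mathrm{ctype}(\pi)$. The product operator $\circledast$ on polynomials is defined as follows. For $P(x_1,\dots,x_u)=\sum a_{i_1i_2\ldots i_u}x_1^{i_1}x_2^{i_2}\cdots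 x_u^{i_u}$ and $Q(x_1,\dots,x_v)=\sum b_{j_1j_2\ldots j_v}x_1^{j_1}x_2^{j_2}\cdots x_v^{j_v}$, $$P\circledast Q=\sum a_{i_1i_2\ldots i_u}b_{j_1j_2\ldots j_v}\prod_{\substack{1\le l\le u\\ 1\le m\le v}}\left(x_l^{i_l}\circledast x_m^{j_m}\right),\qquad x_l^{i_l}\circledast x_m^{j_m}=x_{\mathrm{lcm}(l,m)}^{\,i_l j_m\gcd(l,m)},$$ the sum being over all pairs of a monomial of $P$ and a monomial of $Q$. Iterated products are evaluated from left to right. *)

theory Defs
  imports
    "HOL-Library.Poly_Mapping"
    "HOL-Combinatorics.Orbits"
    "HOL-Number_Theory.Number_Theory"
begin

text \<open>
  Polynomials over the rationals in indeterminates \<open>x\<^sub>i\<close> indexed by \<open>nat\<close>: an exponent vector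
  has type \<open>nat \<Rightarrow>\<^sub>0 nat\<close>, and the ring multiplication of \<open>Poly_Mapping\<close> is multiplication of
  polynomials. The type also contains an indeterminate with index 0; it does not occur in any
  cycle index.
\<close>

type_synonym monomial = "nat \<Rightarrow>\<^sub>0 nat"
type_synonym rat_mpoly = "monomial \<Rightarrow>\<^sub>0 rat"

definition indet :: "nat \<Rightarrow> rat_mpoly" where
  "indet i = Poly_Mapping.single (Poly_Mapping.single i 1) 1"

definition const_poly :: "rat \<Rightarrow> rat_mpoly" where
  "const_poly c = Poly_Mapping.single 0 c"

text \<open>
  The cycles of a permutation of a finite set are identified with their supports, that is, with
  its orbits.
\<close>

definition cycle_count :: "'a set \<Rightarrow> ('a \<Rightarrow> 'a) \<Rightarrow> nat \<Rightarrow> nat" where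
  "cycle_count A \<pi> i = card {C \<in> orbit \<pi> ` A. card C = i}"

definition ctype :: "'a set \<Rightarrow> ('a \<Rightarrow> 'a) \<Rightarrow> rat_mpoly" where
  "ctype A \<pi> = (\<Prod>i = 1..card A. indet i ^ cycle_count A \<pi> i)"

definition cycle_index :: "('a \<Rightarrow> 'a) set \<Rightarrow> 'a set \<Rightarrow> rat_mpoly" where
  "cycle_index G A = const_poly (1 / of_nat (card G)) * (\<Sum>\<pi>\<in>G. ctype A \<pi>)"

text \<open>
  Factors \<open>x\<^sub>l\<^sup>0\<close> or \<open>x\<^sub>m\<^sup>0\<close> contribute 1, so it suffices to let \<open>l\<close> and \<open>m\<close> range over the indices
  that occur in the two monomials.
\<close>

definition circ_prod :: "rat_mpoly \<Rightarrow> rat_mpoly \<Rightarrow> rat_mpoly"  (infixl "\<circledast>" 70) where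
  "P \<circledast> Q = (\<Sum>s\<in>Poly_Mapping.keys P. \<Sum>t\<in>Poly_Mapping.keys Q.
     const_poly (Poly_Mapping.lookup P s * Poly_Mapping.lookup Q t) *
     (\<Prod>l\<in>Poly_Mapping.keys s. \<Prod>m\<in>Poly_Mapping.keys t.
        indet (lcm l m) ^ (Poly_Mapping.lookup s l * Poly_Mapping.lookup t m * gcd l m)))"

definition Z_mod :: "nat \<Rightarrow> nat set" where
  "Z_mod n = {0..<n}"

text \<open>
  Outside of \<open>Z_mod n\<close> the multiplication map is the identity, following the convention of
  \<open>permutes\<close>.
\<close>

definition mult_map :: "nat \<Rightarrow> nat \<Rightarrow> nat \<Rightarrow> nat" where
  "mult_map n a = (\<lambda>x. if x \<in> Z_mod n then a * x mod n else x)"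

definition U_mod :: "nat \<Rightarrow> (nat \<Rightarrow> nat) set" where
  "U_mod n = mult_map n ` {a \<in> Z_mod n. coprime a n}"

lemma mult_map_permutes:
  assumes "0 < n" "coprime a n"
  shows "mult_map n a permutes Z_mod n"
proof (rule bij_imp_permutes)
  have "inj_on (mult_map n a) (Z_mod n)"
  proof (rule inj_onI)
    fix x y assume xy: "x \<in> Z_mod n" "y \<in> Z_mod n" "mult_map n a x = mult_map n a y"
    then have "[a * x = a * y] (mod n)"
      by (simp add: mult_map_def cong_def)
    then have "[x = y] (mod n)"
      using assms(2) by (simp add: cong_mult_lcancel_nat)
    then show "x = y"
      using xy by (simp add: Z_mod_def cong_def)
  qed
  moreover have "mult_map n a ` Z_mod n \<subseteq> Z_mod n"
    using assms(1) by (auto simp: mult_map_def Z_mod_def)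
  ultimately show "bij_betw (mult_map n a) (Z_mod n) (Z_mod n)"
    by (simp add: bij_betw_def endo_inj_surj Z_mod_def)
qed (simp add: mult_map_def)

lemma inj_on_mult_map: "inj_on (mult_map n) (Z_mod n)"
proof (rule inj_onI)
  fix a b assume ab: "a \<in> Z_mod n" "b \<in> Z_mod n" "mult_map n a = mult_map n b"
  from ab(3) have "mult_map n a 1 = mult_map n b 1"
    by simp
  then show "a = b"
    using ab(1,2) by (cases "n = 1") (auto simp: mult_map_def Z_mod_def)
qed

text \<open>\<open>U_mod n\<close> is the automorphism group of the additive group of residues modulo \<open>n\<close>.\<close>

lemma U_mod_eq_Aut:
  assumes n: "0 < n"
  shows "U_mod n = {\<pi>. \<pi> permutes Z_mod n \<and>
    (\<forall>x\<in>Z_mod n. \<forall>y\<in>Z_mod n. \<pi> ((x + y) mod n) = (\<pi> x + \<pi> y) mod n)}"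
    (is "_ = ?Aut")
proof (intro equalityI subsetI)
  fix \<pi> assume "\<pi> \<in> U_mod n"
  then obtain a where a: "coprime a n" "\<pi> = mult_map n a"
    by (auto simp: U_mod_def)
  have "\<pi> ((x + y) mod n) = (\<pi> x + \<pi> y) mod n" if "x \<in> Z_mod n" "y \<in> Z_mod n" for x y
    using that n unfolding a(2)
    by (simp add: mult_map_def Z_mod_def mod_simps distrib_left)
  then show "\<pi> \<in> ?Aut"
    using mult_map_permutes[OF n a(1)] a(2) by simp
next
  fix \<pi> assume "\<pi> \<in> ?Aut"
  then have perm: "\<pi> permutes Z_mod n"
    and add: "\<And>x y. x \<in> Z_mod n \<Longrightarrow> y \<in> Z_mod n \<Longrightarrow> \<pi> ((x + y) mod n) = (\<pi> x + \<pi> y) mod n"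
    by auto
  have lt: "\<pi> x < n" if "x < n" for x
    using permutes_in_image[OF perm, of x] that by (simp add: Z_mod_def)
  have "\<pi> 0 = (\<pi> 0 + \<pi> 0) mod n"
    using add[of 0 0] n by (simp add: Z_mod_def)
  then have "[\<pi> 0 + 0 = \<pi> 0 + \<pi> 0] (mod n)"
    using lt[OF n] by (simp add: cong_def)
  then have "[0 = \<pi> 0] (mod n)"
    by (simp only: cong_add_lcancel_nat)
  then have zero: "\<pi> 0 = 0"
    using lt[OF n] by (simp add: cong_def)
  define a where "a = \<pi> (1 mod n)"
  have lin: "\<pi> x = a * x mod n" if "x < n" for x
    using that
  proof (induction x)
    case 0
    then show ?case by (simp add: zero)
  next
    case (Suc x)
    have "\<pi> ((x + 1 mod n) mod n) = (\<pi> x + a) mod n"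
      using add[of x "1 mod n"] Suc.prems n by (simp add: a_def Z_mod_def)
    then show ?case
      using Suc n by (simp add: mod_simps add.commute)
  qed
  have "coprime a n"
  proof (cases "n = 1")
    case False
    then have "1 \<in> \<pi> ` Z_mod n"
      using n unfolding permutes_image[OF perm] by (simp add: Z_mod_def)
    then obtain x where "x < n" "1 = a * x mod n"
      using lin by (auto simp: Z_mod_def)
    then have "[a * x = 1] (mod n)"
      using False n by (simp add: cong_def)
    then show ?thesis
      by (metis cong_solve_coprime_nat coprime_iff_invertible_nat One_nat_def)
  qed simp
  moreover have "\<pi> = mult_map n a"
    using lin permutes_not_in[OF perm] by (auto simp: mult_map_def Z_mod_def fun_eq_iff)
  moreover have "a \<in> Z_mod n"
    using lt[of "1 mod n"] n by (simp add: a_def Z_mod_def)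
  ultimately show "\<pi> \<in> U_mod n"
    by (auto simp: U_mod_def)
qed

end

theory Submission
  imports Defs
begin

text \<open>
  For coprime \<open>m\<close> and \<open>n\<close> the Chinese remainder theorem identifies \<open>Z_mod (m * n)\<close> with
  \<open>Z_mod m \<times> Z_mod n\<close> and a multiplier modulo \<open>m * n\<close> with a pair of multipliers. The cycle length of
  a pair of points is the least common multiple of the two cycle lengths. An exponent vector
  \<open>\<lambda>\<close> of cycle counts is determined by the numbers \<open>k * \<lambda>\<^sub>k\<close> of points on cycles of length \<open>k\<close>,
  so it is enough to count points, and the \<open>|C| * |D|\<close> points of a product of two cycles account
  for \<open>gcd |C| |D|\<close> cycles of length \<open>lcm |C| |D|\<close>. As the cycle indices are sums of
  monomials and \<open>\<circledast>\<close> is bilinear, the cycle index is multiplicative on coprime moduli.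
\<close>

text \<open>
  Bilinearity of \<open>\<circledast>\<close>, both on coefficients and on exponents, comes from this lemma: a function
  additive in the coefficient does not see that monomials of a sum may coincide or cancel.
\<close>

lemma sum_keys_sum_single:
  fixes f :: "'i \<Rightarrow> 'k" and c :: "'i \<Rightarrow> 'v :: comm_monoid_add"
    and h :: "'v \<Rightarrow> 'k \<Rightarrow> 'a :: comm_monoid_add"
  assumes "finite I" and zero: "\<And>k. h 0 k = 0" and add: "\<And>a b k. h (a + b) k = h a k + h b k"
  defines "P \<equiv> \<Sum>i\<in>I. Poly_Mapping.single (f i) (c i)"
  shows "(\<Sum>k\<in>Poly_Mapping.keys P. h (Poly_Mapping.lookup P k) k) = (\<Sum>i\<in>I. h (c i) (f i))"
proof -
  have h_sum: "h (\<Sum>i\<in>J. d i) k = (\<Sum>i\<in>J. h (d i) k)" for d :: "'i \<Rightarrow> 'v" and J k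
    by (induction J rule: infinite_finite_induct) (simp_all add: zero add)
  have lookup: "Poly_Mapping.lookup P k = (\<Sum>i | i \<in> I \<and> f i = k. c i)" for k
    unfolding P_def lookup_sum lookup_single when_def
    using \<open>finite I\<close> by (simp add: sum.inter_filter)
  have "Poly_Mapping.lookup P k = 0" if "k \<notin> f ` I" for k
    using that unfolding lookup by (intro sum.neutral) auto
  then have "Poly_Mapping.keys P \<subseteq> f ` I"
    by (auto simp: in_keys_iff)
  then have "(\<Sum>k\<in>Poly_Mapping.keys P. h (Poly_Mapping.lookup P k) k)
      = (\<Sum>k\<in>f ` I. h (Poly_Mapping.lookup P k) k)"
    using \<open>finite I\<close> by (intro sum.mono_neutral_left) (auto simp: in_keys_iff zero)
  also have "\<dots> = (\<Sum>k\<in>f ` I. \<Sum>i | i \<in> I \<and> f i = k. h (c i) (f i))"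
    unfolding lookup h_sum by (intro sum.cong) auto
  also have "\<dots> = (\<Sum>i\<in>I. h (c i) (f i))"
    using \<open>finite I\<close> by (rule sum.image_gen [symmetric])
  finally show ?thesis .
qed

section \<open>Polynomials and exponent vectors as sums of single terms\<close>

lemma indet_power: "indet i ^ k = Poly_Mapping.single (Poly_Mapping.single i k) 1"
  by (induction k) (simp_all add: indet_def mult_single flip: single_add)

lemma prod_single_one:
  "(\<Prod>i\<in>I. Poly_Mapping.single (s i) (1 :: rat))
    = Poly_Mapping.single (\<Sum>i\<in>I. s i :: monomial) 1"
  by (induction I rule: infinite_finite_induct) (simp_all add: mult_single)

text \<open>With exponent vectors written additively, \<open>\<circledast>\<close> has the same
  shape on monomials as on polynomials, so \<open>sum_keys_sum_single\<close> serves both.\<close>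

definition circ_monomial :: "monomial \<Rightarrow> monomial \<Rightarrow> monomial" where
  "circ_monomial s t = (\<Sum>l\<in>Poly_Mapping.keys s. \<Sum>m\<in>Poly_Mapping.keys t.
     Poly_Mapping.single (lcm l m) (Poly_Mapping.lookup s l * Poly_Mapping.lookup t m * gcd l m))"

lemma circ_prod_altdef:
  "P \<circledast> Q = (\<Sum>s\<in>Poly_Mapping.keys P. \<Sum>t\<in>Poly_Mapping.keys Q.
     Poly_Mapping.single (circ_monomial s t) (Poly_Mapping.lookup P s * Poly_Mapping.lookup Q t))"
  by (simp add: circ_prod_def circ_monomial_def const_poly_def indet_power prod_single_one
    mult_single)

text \<open>Bilinearity in the coefficients: cycle indices can be multiplied one group element at a
  time, even when several elements share a cycle type.\<close>

lemma circ_prod_sum_single: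
  assumes "finite I" "finite J"
  shows "(\<Sum>i\<in>I. Poly_Mapping.single (f i) (c i)) \<circledast> (\<Sum>j\<in>J. Poly_Mapping.single (g j) (d j))
    = (\<Sum>i\<in>I. \<Sum>j\<in>J. Poly_Mapping.single (circ_monomial (f i) (g j)) (c i * d j))"
    (is "?P \<circledast> ?Q = _")
proof -
  have "?P \<circledast> ?Q = (\<Sum>i\<in>I. \<Sum>t\<in>Poly_Mapping.keys ?Q.
      Poly_Mapping.single (circ_monomial (f i) t) (c i * Poly_Mapping.lookup ?Q t))"
    unfolding circ_prod_altdef
    by (intro sum_keys_sum_single assms) (simp_all add: distrib_right single_add sum.distrib)
  also have "\<dots> = (\<Sum>i\<in>I. \<Sum>j\<in>J.
      Poly_Mapping.single (circ_monomial (f i) (g j)) (c i * d j))"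
    by (intro sum.cong refl sum_keys_sum_single assms) (simp_all add: distrib_left single_add)
  finally show ?thesis .
qed

text \<open>The rule for two powers is additive in each exponent, so monomials can be combined cycle
  by cycle, with repeated lengths allowed.\<close>

lemma circ_monomial_sum_single:
  assumes "finite I" "finite J"
  shows "circ_monomial (\<Sum>i\<in>I. Poly_Mapping.single (f i) (c i)) (\<Sum>j\<in>J. Poly_Mapping.single (g j) (d j))
    = (\<Sum>i\<in>I. \<Sum>j\<in>J. Poly_Mapping.single (lcm (f i) (g j)) (c i * d j * gcd (f i) (g j)))"
    (is "circ_monomial ?s ?t = _")
proof -
  have "circ_monomial ?s ?t = (\<Sum>i\<in>I. \<Sum>m\<in>Poly_Mapping.keys ?t.
      Poly_Mapping.single (lcm (f i) m) (c i * Poly_Mapping.lookup ?t m * gcd (f i) m))"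
    unfolding circ_monomial_def
    by (intro sum_keys_sum_single assms) (simp_all add: distrib_right single_add sum.distrib)
  also have "\<dots> = (\<Sum>i\<in>I. \<Sum>j\<in>J.
      Poly_Mapping.single (lcm (f i) (g j)) (c i * d j * gcd (f i) (g j)))"
    by (intro sum.cong refl sum_keys_sum_single assms)
      (simp_all add: distrib_left distrib_right single_add)
  finally show ?thesis .
qed

section \<open>Cycle lengths and cycle counts\<close>

lemma funpow_eq_self_iff_card_orbit_dvd:
  assumes "x \<in> orbit f x"
  shows "(f ^^ k) x = x \<longleftrightarrow> card (orbit f x) dvd k"
proof -
  \<comment> \<open>This is the least positive return time; \<open>funpow_dist f x x\<close> would
    be 0.\<close>
  let ?d = "funpow_dist1 f x x"
  have d: "(f ^^ ?d) x = x"
    using assms by (rule funpow_dist1_prop)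
  have card: "card (orbit f x) = ?d"
    unfolding orbit_conv_funpow_dist1 [OF assms]
    by (simp only: card_image [OF inj_on_funpow_dist1 [OF assms]] card_atLeastLessThan diff_zero)
  have "(f ^^ k) x = (f ^^ (k mod ?d)) x"
    using d by (rule funpow_mod_eq [symmetric])
  \<comment> \<open>The remainder lies below the least positive return time, so only remainder 0
    leads back to \<open>x\<close>.\<close>
  moreover have "(f ^^ (k mod ?d)) x = x \<longleftrightarrow> k mod ?d = 0"
    using funpow_dist1_least [of "k mod ?d" f x x] mod_less_divisor [of ?d k]
    by (cases "k mod ?d = 0") (simp_all only: funpow_0 neq0_conv zero_less_Suc simp_thms)
  ultimately show ?thesis
    unfolding card by (simp only: dvd_eq_mod_eq_0)
qed

text \<open>The exponent vector of \<open>ctype\<close>, with one summand per cycle instead of one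
  per length, as \<open>circ_monomial_sum_single\<close> expects.\<close>

definition cycle_monomial :: "'a set \<Rightarrow> ('a \<Rightarrow> 'a) \<Rightarrow> monomial" where
  "cycle_monomial A f = (\<Sum>C\<in>orbit f ` A. Poly_Mapping.single (card C) 1)"

context
  fixes A :: "'a set" and f :: "'a \<Rightarrow> 'a"
  assumes finite: "finite A" and permutes: "f permutes A"
begin

lemma self_in_orbit: "x \<in> orbit f x"
  using finite permutes by (intro permutation_self_in_orbit) (auto simp: permutation_permutes)

lemma card_orbit_pos: "0 < card (orbit f x)"
  using self_in_orbit [of x] finite_orbit [of x f] by (auto simp: card_gt_0_iff)

lemma ctype_eq_single: "ctype A f = Poly_Mapping.single (cycle_monomial A f) 1"
proof -
  \<comment> \<open>Every cycle length lies in the index range of \<open>ctype\<close>, so grouping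
    the cycles by length loses none.\<close>
  have "card (orbit f x) \<in> {1..card A}" if "x \<in> A" for x
    using card_orbit_pos [of x] permutes_orbit_subset [OF permutes that] finite
    by (auto simp: card_mono)
  then have "(\<Sum>C\<in>orbit f ` A. Poly_Mapping.single (card C) 1)
      = (\<Sum>i = 1..card A. \<Sum>C | C \<in> orbit f ` A \<and> card C = i. Poly_Mapping.single (card C) (1 :: nat))"
    using finite by (intro sum.group [symmetric]) auto
  also have "\<dots> = (\<Sum>i = 1..card A. Poly_Mapping.single i (cycle_count A f i))"
  proof (intro sum.cong refl)
    fix i
    have "(\<Sum>C\<in>X. Poly_Mapping.single (card C) 1) = Poly_Mapping.single i (card X)"
      if "\<forall>C\<in>X. card C = i" "finite X" for X :: "'a set set"
      using that(2,1) by (induction X) (simp_all add: single_add [symmetric])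
    then show "(\<Sum>C | C \<in> orbit f ` A \<and> card C = i. Poly_Mapping.single (card C) 1)
        = Poly_Mapping.single i (cycle_count A f i)"
      unfolding cycle_count_def using finite by simp
  qed
  finally show ?thesis
    by (simp add: ctype_def cycle_monomial_def indet_power prod_single_one)
qed

text \<open>Double counting: orbits partition \<open>A\<close>, so a cycle \<open>C\<close> is the
  orbit of exactly \<open>card C\<close> points.\<close>

lemma sum_card_orbits: "(\<Sum>C\<in>orbit f ` A. card C * g C) = (\<Sum>x\<in>A. g (orbit f x))"
proof -
  have "{y \<in> A. orbit f y = orbit f x} = orbit f x" if "x \<in> A" for x
    using permutes_orbit_subset [OF permutes that] self_in_orbit
      orbit_cyclic_eq3 [OF cyclic_on_orbit [OF permutes finite]] by blast
  then have "(\<Sum>C\<in>orbit f ` A. card C * g C)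
      = (\<Sum>C\<in>orbit f ` A. \<Sum>y | y \<in> A \<and> orbit f y = C. g (orbit f y))"
    by (intro sum.cong) auto
  also have "\<dots> = (\<Sum>x\<in>A. g (orbit f x))"
    using finite by (rule sum.image_gen [symmetric])
  finally show ?thesis .
qed

lemma mult_lookup_cycle_monomial:
  "k * Poly_Mapping.lookup (cycle_monomial A f) k = (\<Sum>x\<in>A. if card (orbit f x) = k then 1 else 0)"
  unfolding cycle_monomial_def lookup_sum lookup_single sum_distrib_left
    sum_card_orbits [of "\<lambda>C. if card C = k then 1 else 0", symmetric]
  by (intro sum.cong) (auto simp: when_def)

text \<open>Counting points determines the exponent at \<open>k\<close> only for positive
  \<open>k\<close>; the exponent at 0 is settled here.\<close>

lemma lookup_cycle_monomial_0: "Poly_Mapping.lookup (cycle_monomial A f) 0 = 0"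
  using card_orbit_pos
  by (auto simp: cycle_monomial_def lookup_sum lookup_single when_def intro!: sum.neutral)

end

text \<open>A cycle monomial depends only on how many points lie in orbits of each size, so it
  suffices that \<open>\<phi>\<close> matches these sizes with least common multiples.\<close>

lemma cycle_monomial_product:
  assumes A: "finite A" "f permutes A" and B: "finite B" "g permutes B"
    and E: "finite E" "h permutes E"
    and bij: "bij_betw \<phi> E (A \<times> B)"
    and card: "\<And>z x y. z \<in> E \<Longrightarrow> \<phi> z = (x, y) \<Longrightarrow>
      card (orbit h z) = lcm (card (orbit f x)) (card (orbit g y))"
  shows "cycle_monomial E h = circ_monomial (cycle_monomial A f) (cycle_monomial B g)"
proof (rule poly_mapping_eqI)
  fix k
  have lookup: "Poly_Mapping.lookup (circ_monomial (cycle_monomial A f) (cycle_monomial B g)) k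
      = (\<Sum>C\<in>orbit f ` A. \<Sum>D\<in>orbit g ` B. if lcm (card C) (card D) = k then gcd (card C) (card D) else 0)"
    using A(1) B(1) unfolding cycle_monomial_def
    by (simp add: circ_monomial_sum_single lookup_sum lookup_single when_def)
  show "Poly_Mapping.lookup (cycle_monomial E h) k
      = Poly_Mapping.lookup (circ_monomial (cycle_monomial A f) (cycle_monomial B g)) k"
  proof (cases "k = 0")
    case True
    have "lcm (card C) (card D) \<noteq> 0" if "C \<in> orbit f ` A" "D \<in> orbit g ` B" for C D
      using that card_orbit_pos [OF A] card_orbit_pos [OF B] by (metis imageE lcm_eq_0_iff less_irrefl)
    then show ?thesis
      unfolding True lookup [unfolded True] lookup_cycle_monomial_0 [OF E]
      by (intro sum.neutral [symmetric] ballI sum.neutral if_not_P)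
  next
    case False
    \<comment> \<open>This is \<open>gcd c d * lcm c d = c * d\<close>; it trades the number of
      points in a product of two cycles for the number of cycles there.\<close>
    have points_eq: "c * (d * (if lcm c d = k then 1 else 0)) = k * (if lcm c d = k then gcd c d else 0)"
      for c d :: nat
      by (cases "lcm c d = k") (metis mult.commute mult_1_right prod_gcd_lcm_nat, simp)
    have "k * Poly_Mapping.lookup (cycle_monomial E h) k
        = (\<Sum>z\<in>E. case \<phi> z of (x, y) \<Rightarrow>
            if lcm (card (orbit f x)) (card (orbit g y)) = k then 1 else 0)"
      unfolding mult_lookup_cycle_monomial [OF E]
      by (intro sum.cong) (auto simp: card split: prod.split)
    also have "\<dots> = (\<Sum>(x, y)\<in>A \<times> B. if lcm (card (orbit f x)) (card (orbit g y)) = k then 1 else 0)"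
      using bij by (rule sum.reindex_bij_betw)
    also have "\<dots> = (\<Sum>C\<in>orbit f ` A. card C * (\<Sum>D\<in>orbit g ` B. card D *
        (if lcm (card C) (card D) = k then 1 else 0)))"
      unfolding sum_card_orbits [OF A] sum_card_orbits [OF B] sum.cartesian_product ..
    also have "\<dots> = k * Poly_Mapping.lookup (circ_monomial (cycle_monomial A f) (cycle_monomial B g)) k"
      unfolding lookup sum_distrib_left points_eq ..
    finally show ?thesis
      using False by simp
  qed
qed

section \<open>Multiplication maps and the Chinese remainder theorem\<close>

text \<open>Injectivity is the uniqueness half of the Chinese remainder theorem; surjectivity
  follows because both sides have \<open>m * n\<close> elements.\<close>

lemma bij_betw_mod_pair:
  assumes "coprime m n" "0 < m" "0 < n"
  shows "bij_betw (\<lambda>x. (x mod m, x mod n)) (Z_mod (m * n)) (Z_mod m \<times> Z_mod n)"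
proof -
  let ?\<phi> = "\<lambda>x. (x mod m, x mod n)"
  have "inj_on ?\<phi> (Z_mod (m * n))"
  proof (rule inj_onI)
    fix x y assume "x \<in> Z_mod (m * n)" "y \<in> Z_mod (m * n)" "?\<phi> x = ?\<phi> y"
    then show "x = y"
      using coprime_cong_mult_nat [of x y m n] assms(1) by (simp add: cong_def Z_mod_def)
  qed
  moreover have "?\<phi> ` Z_mod (m * n) \<subseteq> Z_mod m \<times> Z_mod n"
    using assms by (auto simp: Z_mod_def)
  ultimately show ?thesis
    unfolding bij_betw_def
    by (intro conjI card_subset_eq) (simp_all add: card_image, simp_all add: Z_mod_def)
qed

lemma funpow_mult_map:
  assumes "x \<in> Z_mod n"
  shows "(mult_map n a ^^ k) x = a ^ k * x mod n"
  using assms by (induction k) (auto simp: mult_map_def Z_mod_def mod_mult_right_eq mult.assoc)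

lemma mult_map_mod: "mult_map n (a mod n) = mult_map n a"
  by (auto simp: mult_map_def mod_mult_left_eq)

text \<open>The multipliers are kept as numbers rather than maps, so that they can be reduced modulo
  each factor.\<close>

definition units :: "nat \<Rightarrow> nat set" where
  "units n = {a \<in> Z_mod n. coprime a n}"

lemma finite_units: "finite (units n)"
  by (simp add: units_def Z_mod_def)

text \<open>Distinct multipliers in \<open>units n\<close> give distinct maps, so the group can be
  indexed by multipliers. Equal monomials stay uncollected, ready for
  \<open>circ_prod_sum_single\<close>.\<close>

lemma cycle_index_eq_sum_single:
  assumes "0 < n"
  shows "cycle_index (U_mod n) (Z_mod n) =
    (\<Sum>a\<in>units n. Poly_Mapping.single (cycle_monomial (Z_mod n) (mult_map n a)) (1 / of_nat (card (units n))))"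
proof -
  have inj: "inj_on (mult_map n) (units n)"
    using inj_on_mult_map by (rule inj_on_subset) (auto simp: units_def)
  have U_mod: "U_mod n = mult_map n ` units n"
    by (simp add: U_mod_def units_def)
  have "ctype (Z_mod n) (mult_map n a) = Poly_Mapping.single (cycle_monomial (Z_mod n) (mult_map n a)) 1"
    if "a \<in> units n" for a
    using that assms by (intro ctype_eq_single mult_map_permutes) (auto simp: units_def Z_mod_def)
  then show ?thesis
    using inj by (simp add: cycle_index_def U_mod card_image sum.reindex const_poly_def
      sum_distrib_left mult_single)
qed

context
  fixes m n :: nat
  assumes coprime: "coprime m n" and pos: "0 < m" "0 < n"
begin

text \<open>The multiples of an orbit size are the \<open>k\<close> for which multiplying by
  \<open>a ^ k\<close> fixes the point. Modulo \<open>m * n\<close> this congruence splits into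
  those modulo \<open>m\<close> and \<open>n\<close>, so the orbit size and the lcm have the same
  multiples.\<close>

lemma card_orbit_mult_map:
  assumes a: "coprime a (m * n)" and x: "x \<in> Z_mod (m * n)"
  shows "card (orbit (mult_map (m * n) a) x)
    = lcm (card (orbit (mult_map m a) (x mod m))) (card (orbit (mult_map n a) (x mod n)))"
proof (rule dvd_antisym)
  have dvd: "card (orbit (mult_map r a) y) dvd k \<longleftrightarrow> [a ^ k * y = y] (mod r)"
    if "0 < r" "coprime a r" "y \<in> Z_mod r" for r y k
  proof -
    have "y \<in> orbit (mult_map r a) y"
      using mult_map_permutes [OF that(1,2)] by (intro self_in_orbit) (simp_all add: Z_mod_def)
    from funpow_eq_self_iff_card_orbit_dvd [OF this, of k] show ?thesis
      using that by (simp add: funpow_mult_map cong_def Z_mod_def)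
  qed
  have coprime_a: "coprime a m" "coprime a n"
    using a by simp_all
  have mem: "x mod m \<in> Z_mod m" "x mod n \<in> Z_mod n"
    using pos by (simp_all add: Z_mod_def)
  have iff: "card (orbit (mult_map (m * n) a) x) dvd k \<longleftrightarrow>
      card (orbit (mult_map m a) (x mod m)) dvd k \<and> card (orbit (mult_map n a) (x mod n)) dvd k" for k
  proof -
    have "[a ^ k * x = x] (mod (m * n)) \<longleftrightarrow> [a ^ k * x = x] (mod m) \<and> [a ^ k * x = x] (mod n)"
      by (meson coprime coprime_cong_mult_nat cong_dvd_modulus_nat dvd_triv_left dvd_triv_right)
    then show ?thesis
      using pos a coprime_a x mem
      by (simp add: dvd cong_def mod_mult_right_eq)
  qed
  \<comment> \<open>Each divisibility is \<open>iff\<close> at one of the two numbers: first at the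
    lcm, then at the orbit size itself.\<close>
  show "card (orbit (mult_map (m * n) a) x) dvd
      lcm (card (orbit (mult_map m a) (x mod m))) (card (orbit (mult_map n a) (x mod n)))"
    unfolding iff by simp
  show "lcm (card (orbit (mult_map m a) (x mod m))) (card (orbit (mult_map n a) (x mod n)))
      dvd card (orbit (mult_map (m * n) a) x)"
    using iff [of "card (orbit (mult_map (m * n) a) x)"] by simp
qed

lemma cycle_monomial_mult_map:
  assumes a: "coprime a (m * n)"
  shows "cycle_monomial (Z_mod (m * n)) (mult_map (m * n) a) =
    circ_monomial (cycle_monomial (Z_mod m) (mult_map m a)) (cycle_monomial (Z_mod n) (mult_map n a))"
proof (rule cycle_monomial_product [OF _ _ _ _ _ _ bij_betw_mod_pair [OF coprime pos]])
  fix z x y assume "z \<in> Z_mod (m * n)" "(z mod m, z mod n) = (x, y)"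
  then show "card (orbit (mult_map (m * n) a) z)
      = lcm (card (orbit (mult_map m a) x)) (card (orbit (mult_map n a) y))"
    using card_orbit_mult_map [OF a, of z] by simp
qed (use a pos in \<open>simp_all add: mult_map_permutes, simp_all add: Z_mod_def\<close>)

text \<open>The bijection of residues restricts to units because \<open>x\<close> is coprime to
  \<open>m * n\<close> exactly when its residues are coprime to \<open>m\<close> and
  \<open>n\<close>.\<close>

lemma bij_betw_units:
  "bij_betw (\<lambda>x. (x mod m, x mod n)) (units (m * n)) (units m \<times> units n)"
proof (rule bij_betw_subset [OF bij_betw_mod_pair [OF coprime pos]])
  let ?\<phi> = "\<lambda>x. (x mod m, x mod n)"
  have units_iff: "x \<in> units (m * n) \<longleftrightarrow> ?\<phi> x \<in> units m \<times> units n" if "x \<in> Z_mod (m * n)" for x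
    using that pos by (simp add: units_def Z_mod_def coprime_mod_left_iff)
  have "units m \<times> units n \<subseteq> ?\<phi> ` Z_mod (m * n)"
    unfolding bij_betw_imp_surj_on [OF bij_betw_mod_pair [OF coprime pos]] by (auto simp: units_def)
  then have "units m \<times> units n \<subseteq> ?\<phi> ` units (m * n)"
    using units_iff by blast
  then show "?\<phi> ` units (m * n) = units m \<times> units n"
    using units_iff by (auto simp: units_def)
qed (auto simp: units_def)

lemma cycle_index_U_mod_mult:
  "cycle_index (U_mod (m * n)) (Z_mod (m * n)) =
    cycle_index (U_mod m) (Z_mod m) \<circledast> cycle_index (U_mod n) (Z_mod n)"
proof -
  let ?M = "\<lambda>r a. cycle_monomial (Z_mod r) (mult_map r a)"
  let ?c = "1 / of_nat (card (units m)) * (1 / of_nat (card (units n))) :: rat"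
  have coprime_units: "coprime a m" "coprime a n" if "a \<in> units (m * n)" for a
    using that by (simp_all add: units_def)
  \<comment> \<open>This makes the normalising factor of the left side the product of the two on the
    right.\<close>
  have card: "card (units (m * n)) = card (units m) * card (units n)"
    using bij_betw_same_card [OF bij_betw_units] by (simp add: card_cartesian_product)
  have "cycle_index (U_mod (m * n)) (Z_mod (m * n))
      = (\<Sum>a\<in>units (m * n). Poly_Mapping.single (circ_monomial (?M m a) (?M n a)) ?c)"
    unfolding cycle_index_eq_sum_single [OF mult_pos_pos [OF pos]]
    by (intro sum.cong refl) (simp add: coprime_units cycle_monomial_mult_map card)
  \<comment> \<open>Replacing \<open>a\<close> by its residues leaves both maps unchanged and makes
    the summand a function of the pair, ready for reindexing.\<close>
  also have "\<dots> = (\<Sum>a\<in>units (m * n). case (a mod m, a mod n) of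
      (b, c) \<Rightarrow> Poly_Mapping.single (circ_monomial (?M m b) (?M n c)) ?c)"
    by (simp add: mult_map_mod)
  also have "\<dots> = (\<Sum>(b, c)\<in>units m \<times> units n.
      Poly_Mapping.single (circ_monomial (?M m b) (?M n c)) ?c)"
    using bij_betw_units by (rule sum.reindex_bij_betw)
  also have "\<dots> = cycle_index (U_mod m) (Z_mod m) \<circledast> cycle_index (U_mod n) (Z_mod n)"
    unfolding cycle_index_eq_sum_single [OF pos(1)] cycle_index_eq_sum_single [OF pos(2)]
      circ_prod_sum_single [OF finite_units finite_units] sum.cartesian_product ..
  finally show ?thesis .
qed

end

section \<open>Induction on the number of prime powers\<close>

theorem mainTheorem4:
  fixes n s :: nat and p \<alpha> :: "nat \<Rightarrow> nat"
  assumes "s \<ge> 1"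
    and "\<And>i. i \<in> {1..s} \<Longrightarrow> prime (p i)"
    and "inj_on p {1..s}"
    and "\<And>i. i \<in> {1..s} \<Longrightarrow> \<alpha> i \<ge> 1"
    and "n = (\<Prod>i = 1..s. p i ^ \<alpha> i)"
  shows "cycle_index (U_mod n) (Z_mod n) =
    foldl (\<circledast>) (cycle_index (U_mod (p 1 ^ \<alpha> 1)) (Z_mod (p 1 ^ \<alpha> 1)))
      (map (\<lambda>i. cycle_index (U_mod (p i ^ \<alpha> i)) (Z_mod (p i ^ \<alpha> i))) [2..<Suc s])"
  using assms
\<comment> \<open>The product associates to the left, so the last prime power is split off;
  \<open>n\<close> varies because the shorter product is a different modulus.\<close>
proof (induction s arbitrary: n rule: nat_induct_at_least)
  case base
  then show ?case
    by simp
next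
  case (Suc s)
  let ?m = "\<Prod>i = 1..s. p i ^ \<alpha> i"
  have prime: "prime (p i)" if "i \<in> {1..Suc s}" for i
    using Suc.prems(1) that .
  have "coprime (p i) (p (Suc s))" if "i \<in> {1..s}" for i
    using that prime [of i] prime [of "Suc s"] inj_onD [OF Suc.prems(2), of i "Suc s"]
    by (intro primes_coprime) auto
  then have "coprime ?m (p (Suc s) ^ \<alpha> (Suc s))"
    by (intro prod_coprime_left) simp
  moreover have "0 < ?m" "0 < p (Suc s) ^ \<alpha> (Suc s)"
    using prime by (auto intro!: prod_pos simp: prime_gt_0_nat)
  moreover have "cycle_index (U_mod ?m) (Z_mod ?m) =
      foldl (\<circledast>) (cycle_index (U_mod (p 1 ^ \<alpha> 1)) (Z_mod (p 1 ^ \<alpha> 1)))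
        (map (\<lambda>i. cycle_index (U_mod (p i ^ \<alpha> i)) (Z_mod (p i ^ \<alpha> i))) [2..<Suc s])"
    using Suc.prems by (intro Suc.IH) (auto intro: inj_on_subset)
  moreover have "n = ?m * p (Suc s) ^ \<alpha> (Suc s)"
    using Suc.prems(4) by simp
  \<comment> \<open>The last index can be split off because \<open>s\<close> is at least 1; for
    \<open>s = 0\<close> the left side would be empty.\<close>
  moreover have "[2..<Suc (Suc s)] = [2..<Suc s] @ [Suc s]"
    using Suc.hyps by simp
  ultimately show ?case
    by (simp only: cycle_index_U_mod_mult map_append foldl_append list.map foldl.simps)
qed

end
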